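(* Let $X$ be an interval space. Then the following conditions are equivalent: (1) $X$ is interval-transitive. (2) For all $a,b,c\in X$, $[\{a\},[b,c]]\subseteq[[a,b],\{c\}]$. (3) For all $a,b,c\in X$, $[\{a\},[b,c]]=[[a,b],\{c\}]$. (4) The power set $P(X)$ with the binary operation $(A,C)\mapsto[A,C]$ is a semigroup. (5) The power set $P(X)$ with the binary operation $(A,C)\mapsto[A,C]$ is a commutative semigroup. (6) $X$ is interval-convex, and for each convex set $A\subseteq X$, the binary relation $\langle A,\cdot,\cdot\rangle$ on $X$ is transitive. (7) For all convex sets $A,B\subseteq X$, the set $[A,B]$ is convex. (8) For all $a,b,c\in X$, the set $[[a,b],\{c\}]$ is convex. (9) For all $a,b,c\in X$, $\mathrm{co}(\{a,b,c\})=[[a,b],\{c\}]$.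
   Context: An interval space is a set $X$ with a ternary relation $\langle\cdot,\cdot,\cdot\rangle$ such that: for each $a\in X$ the binary relations $\langle\cdot,\cdot,a\rangle$ and $\langle a,\cdot,\cdot\rangle$ are reflexive on $X$ (i.e. $\langle x,x,a\rangle$ and $\langle a,x,x\rangle$ for all $x$); for each $a\in X$ the binary relation $\langle\cdot,a,\cdot\rangle$ is symmetric (i.e. $\langle x,a,z\rangle\Rightarrow\langle z,a,x\rangle$); and $\langle x,y,x\rangle$ implies $y=x$. For $A\subseteq X$ and $b,c\in X$, $\langle A,b,c\rangle$ means there is $a\in A$ with $\langle a,b,c\rangle$. For $A,C\subseteq X$ and $b\in X$, $\langle A,b,C\rangle$ means there are $a\in A$, $c\in C$ with $\langle a,b,c\rangle$. For $a,c\in X$, $[a,c]=\{x\in X:\langle a,x,c\rangle\}$; for $A,C\subseteq X$, $[A,C]=\{x\in X:\langle A,x,C\rangle\}$. A set $C\subseteq X$ is convex iff $[C,C]\subseteq C$. For $A\subseteq X$, $\mathrm{co}(A)$ is the intersection of all convex supersets of $A$. $X$ is interval-transitive iff for all $a,b\in X$ the binary relation $\langle[a,b],\cdot,\cdot\rangle$ on $X$ is transitive. $X$ is interval-convex iff for all $a,b\in X$, $[a,b]$ is convex. *)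

theory Defs
  imports Main
begin

locale interval_space =
  fixes X :: "'a set" and R :: "'a \<Rightarrow> 'a \<Rightarrow> 'a \<Rightarrow> bool"
  assumes refl_left: "a \<in> X \<Longrightarrow> reflp_on X (\<lambda>x y. R x y a)"
    and refl_right: "a \<in> X \<Longrightarrow> reflp_on X (\<lambda>x y. R a x y)"
    and sym_outer: "a \<in> X \<Longrightarrow> symp_on X (\<lambda>x z. R x a z)"
    and degenerate: "x \<in> X \<Longrightarrow> y \<in> X \<Longrightarrow> R x y x \<Longrightarrow> y = x"

definition set_rel :: "('a \<Rightarrow> 'a \<Rightarrow> 'a \<Rightarrow> bool) \<Rightarrow> 'a set \<Rightarrow> 'a \<Rightarrow> 'a \<Rightarrow> bool"
  where "set_rel R A b c \<longleftrightarrow> (\<exists>a\<in>A. R a b c)"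

definition set_rel2 :: "('a \<Rightarrow> 'a \<Rightarrow> 'a \<Rightarrow> bool) \<Rightarrow> 'a set \<Rightarrow> 'a \<Rightarrow> 'a set \<Rightarrow> bool"
  where "set_rel2 R A b C \<longleftrightarrow> (\<exists>a\<in>A. \<exists>c\<in>C. R a b c)"

definition interval :: "'a set \<Rightarrow> ('a \<Rightarrow> 'a \<Rightarrow> 'a \<Rightarrow> bool) \<Rightarrow> 'a \<Rightarrow> 'a \<Rightarrow> 'a set"
  where "interval X R a c = {x \<in> X. R a x c}"

definition set_interval :: "'a set \<Rightarrow> ('a \<Rightarrow> 'a \<Rightarrow> 'a \<Rightarrow> bool) \<Rightarrow> 'a set \<Rightarrow> 'a set \<Rightarrow> 'a set"
  where "set_interval X R A C = {x \<in> X. set_rel2 R A x C}"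

definition interval_convex_set :: "'a set \<Rightarrow> ('a \<Rightarrow> 'a \<Rightarrow> 'a \<Rightarrow> bool) \<Rightarrow> 'a set \<Rightarrow> bool"
  where "interval_convex_set X R C \<longleftrightarrow> C \<subseteq> X \<and> set_interval X R C C \<subseteq> C"

definition co :: "'a set \<Rightarrow> ('a \<Rightarrow> 'a \<Rightarrow> 'a \<Rightarrow> bool) \<Rightarrow> 'a set \<Rightarrow> 'a set"
  where "co X R A = \<Inter> {C. interval_convex_set X R C \<and> A \<subseteq> C}"

definition interval_transitive :: "'a set \<Rightarrow> ('a \<Rightarrow> 'a \<Rightarrow> 'a \<Rightarrow> bool) \<Rightarrow> bool"
  where "interval_transitive X R \<longleftrightarrow>
    (\<forall>a\<in>X. \<forall>b\<in>X. transp_on X (set_rel R (interval X R a b)))"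

definition interval_convex :: "'a set \<Rightarrow> ('a \<Rightarrow> 'a \<Rightarrow> 'a \<Rightarrow> bool) \<Rightarrow> bool"
  where "interval_convex X R \<longleftrightarrow>
    (\<forall>a\<in>X. \<forall>b\<in>X. interval_convex_set X R (interval X R a b))"

text \<open>The locales \<^locale>\<open>semigroup\<close> and \<^locale>\<open>abel_semigroup\<close> speak about operations on a whole
  type; a power set \<^term>\<open>Pow X\<close> needs the versions relative to a carrier.\<close>

definition semigroup_on :: "'b set \<Rightarrow> ('b \<Rightarrow> 'b \<Rightarrow> 'b) \<Rightarrow> bool"
  where "semigroup_on S f \<longleftrightarrow>
    (\<forall>x\<in>S. \<forall>y\<in>S. f x y \<in> S) \<and>
    (\<forall>x\<in>S. \<forall>y\<in>S. \<forall>z\<in>S. f (f x y) z = f x (f y z))"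

definition comm_semigroup_on :: "'b set \<Rightarrow> ('b \<Rightarrow> 'b \<Rightarrow> 'b) \<Rightarrow> bool"
  where "comm_semigroup_on S f \<longleftrightarrow>
    semigroup_on S f \<and> (\<forall>x\<in>S. \<forall>y\<in>S. f x y = f y x)"

end

theory Submission
  imports Defs
begin

text \<open>
  Condition (2) says that the operation \<open>[A, C]\<close> on subsets is sub-associative on singletons;
  since the operation is commutative, this already forces associativity (4). Singletons, and more
  generally convex sets, satisfy \<open>[A, A] \<subseteq> A\<close>, so in the commutative semigroup
  \<open>[[A, B], [A, B]] = [[A, A], [B, B]] \<subseteq> [A, B]\<close>, which gives (7), in particular convexity of
  intervals. Interval-convexity and (2) give transitivity of \<open>\<langle>A, \<cdot>, \<cdot>\<rangle>\<close> for convex \<open>A\<close>.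
  The cycle is closed by \<open>[{a}, [b, c]] \<subseteq> co {a, b, c}\<close>, which always holds.
\<close>

section \<open>Set intervals, convex sets and hulls\<close>

lemma mem_set_interval_iff:
  "x \<in> set_interval X R A C \<longleftrightarrow> x \<in> X \<and> (\<exists>a\<in>A. \<exists>c\<in>C. R a x c)"
  by (simp add: set_interval_def set_rel2_def)

lemma set_intervalI:
  "a \<in> A \<Longrightarrow> c \<in> C \<Longrightarrow> x \<in> X \<Longrightarrow> R a x c \<Longrightarrow> x \<in> set_interval X R A C"
  by (auto simp: mem_set_interval_iff)

lemma mem_interval_iff: "x \<in> interval X R a c \<longleftrightarrow> x \<in> X \<and> R a x c"
  by (simp add: interval_def)

lemma set_interval_subset: "set_interval X R A C \<subseteq> X"
  by (auto simp: mem_set_interval_iff)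

lemma set_interval_mono:
  "A \<subseteq> A' \<Longrightarrow> C \<subseteq> C' \<Longrightarrow> set_interval X R A C \<subseteq> set_interval X R A' C'"
  by (force simp: mem_set_interval_iff)

lemma set_interval_singletons: "set_interval X R {a} {c} = interval X R a c"
  by (auto simp: mem_set_interval_iff mem_interval_iff)

lemma interval_convex_setD:
  "interval_convex_set X R C \<Longrightarrow> a \<in> C \<Longrightarrow> c \<in> C \<Longrightarrow> x \<in> X \<Longrightarrow> R a x c \<Longrightarrow> x \<in> C"
  unfolding interval_convex_set_def by (blast intro: set_intervalI)

lemma subset_co: "A \<subseteq> co X R A"
  by (auto simp: co_def)

lemma co_minimal: "interval_convex_set X R C \<Longrightarrow> A \<subseteq> C \<Longrightarrow> co X R A \<subseteq> C"
  by (auto simp: co_def)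

text \<open>An intersection of convex sets is convex. The assumption \<open>A \<subseteq> X\<close>
  makes \<open>X\<close> itself a member of the intersected family; for other \<open>A\<close> that
  family is empty and \<open>co X R A\<close> is the whole type.\<close>

lemma interval_convex_set_co:
  assumes "A \<subseteq> X"
  shows "interval_convex_set X R (co X R A)"
proof -
  have "interval_convex_set X R X"
    by (simp add: interval_convex_set_def set_interval_subset)
  then have "co X R A \<subseteq> X"
    using assms by (rule co_minimal)
  moreover have "x \<in> co X R A"
    if "a \<in> co X R A" "c \<in> co X R A" "x \<in> X" "R a x c" for a c x
    unfolding co_def
  proof (rule InterI)
    fix C
    assume "C \<in> {C. interval_convex_set X R C \<and> A \<subseteq> C}"
    then show "x \<in> C"
      using that interval_convex_setD[of X R C a c x] by (auto simp: co_def)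
  qed
  ultimately show ?thesis
    unfolding interval_convex_set_def subset_iff mem_set_interval_iff by blast
qed

text \<open>Known in geometry as the Peano property. It serves as the hub through which all the
  conditions are connected.\<close>

definition interval_subassoc :: "'a set \<Rightarrow> ('a \<Rightarrow> 'a \<Rightarrow> 'a \<Rightarrow> bool) \<Rightarrow> bool"
  where "interval_subassoc X R \<longleftrightarrow>
    (\<forall>a\<in>X. \<forall>b\<in>X. \<forall>c\<in>X.
      set_interval X R {a} (interval X R b c) \<subseteq> set_interval X R (interval X R a b) {c})"

text \<open>The triangle picture: a point on the segment from \<open>a\<close> to the side
  \<open>b c\<close> also lies on a segment from \<open>c\<close> to a point \<open>z\<close> of the
  side \<open>a b\<close>.\<close>

lemma interval_subassocD:
  assumes "interval_subassoc X R" "a \<in> X" "b \<in> X" "c \<in> X" "x \<in> X" "y \<in> X" "R a x y" "R b y c"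
  obtains z where "z \<in> X" "R a z b" "R z x c"
proof -
  have "x \<in> set_interval X R {a} (interval X R b c)"
    using assms by (auto simp: mem_set_interval_iff mem_interval_iff)
  then have "x \<in> set_interval X R (interval X R a b) {c}"
    using assms(1-4) unfolding interval_subassoc_def by blast
  then show thesis
    using that by (auto simp: mem_set_interval_iff mem_interval_iff)
qed

section \<open>Consequences of the axioms, and the Peano property from transitivity\<close>

context interval_space
begin

lemma rel_left: "x \<in> X \<Longrightarrow> a \<in> X \<Longrightarrow> R x x a"
  using refl_left by (auto dest: reflp_onD)

lemma rel_right: "x \<in> X \<Longrightarrow> a \<in> X \<Longrightarrow> R a x x"
  using refl_right by (auto dest: reflp_onD)

lemma rel_sym: "x \<in> X \<Longrightarrow> a \<in> X \<Longrightarrow> z \<in> X \<Longrightarrow> R x a z \<Longrightarrow> R z a x"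
  using sym_outer by (auto dest: symp_onD)

lemma set_interval_commute:
  assumes "A \<subseteq> X" "C \<subseteq> X"
  shows "set_interval X R A C = set_interval X R C A"
  using assms rel_sym unfolding set_eq_iff mem_set_interval_iff by blast

text \<open>The axiom \<open>degenerate\<close> enters here: nothing but \<open>a\<close> lies
  between \<open>a\<close> and \<open>a\<close>.\<close>

lemma interval_convex_set_singleton: "a \<in> X \<Longrightarrow> interval_convex_set X R {a}"
  by (auto simp: interval_convex_set_def mem_set_interval_iff dest: degenerate)

lemma interval_transitive_imp_subassoc:
  assumes "interval_transitive X R"
  shows "interval_subassoc X R"
  unfolding interval_subassoc_def
proof (intro ballI subsetI)
  fix a b c x
  assume X: "a \<in> X" "b \<in> X" "c \<in> X"
    and "x \<in> set_interval X R {a} (interval X R b c)"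
  then obtain y where y: "y \<in> X" "x \<in> X" "R a x y" "R b y c"
    by (auto simp: mem_set_interval_iff mem_interval_iff)
  let ?S = "set_rel R (interval X R a b)"
  \<comment> \<open>Both endpoints belong to the interval from \<open>a\<close> to \<open>b\<close>,
    so \<open>a\<close> witnesses the first relation and \<open>b\<close> the second. The witness
    for \<open>?S x c\<close> obtained by transitivity is the point required on the side
    \<open>a b\<close>.\<close>
  have "?S x y" "?S y c"
    using X y rel_left rel_right by (auto simp: set_rel_def mem_interval_iff)
  moreover have "transp_on X ?S"
    using assms X by (auto simp: interval_transitive_def)
  ultimately have "?S x c"
    using X y by (meson transp_onD)
  then show "x \<in> set_interval X R (interval X R a b) {c}"
    using y by (auto simp: mem_set_interval_iff set_rel_def)
qed

section \<open>Associativity of the set interval operation\<close>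

lemma set_interval_subassoc:
  assumes "interval_subassoc X R" "A \<subseteq> X" "B \<subseteq> X" "C \<subseteq> X"
  shows "set_interval X R A (set_interval X R B C) \<subseteq> set_interval X R (set_interval X R A B) C"
proof
  fix x
  assume "x \<in> set_interval X R A (set_interval X R B C)"
  then obtain a b c y
    where *: "a \<in> A" "b \<in> B" "c \<in> C" "x \<in> X" "y \<in> X" "R a x y" "R b y c"
    by (auto simp: mem_set_interval_iff)
  obtain z where "z \<in> X" "R a z b" "R z x c"
    by (rule interval_subassocD[OF assms(1), of a b c x y]) (use * assms in auto)
  with * show "x \<in> set_interval X R (set_interval X R A B) C"
    by (blast intro: set_intervalI)
qed

lemma set_interval_assoc:
  assumes "interval_subassoc X R" "A \<subseteq> X" "B \<subseteq> X" "C \<subseteq> X"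
  shows "set_interval X R (set_interval X R A B) C = set_interval X R A (set_interval X R B C)"
proof
  \<comment> \<open>Reversing all factors by commutativity turns this inclusion into the known one
    for \<open>C\<close>, \<open>B\<close>, \<open>A\<close>.\<close>
  have "set_interval X R (set_interval X R A B) C = set_interval X R C (set_interval X R B A)"
    using assms by (simp add: set_interval_commute set_interval_subset)
  also have "\<dots> \<subseteq> set_interval X R (set_interval X R C B) A"
    using assms by (intro set_interval_subassoc)
  also have "\<dots> = set_interval X R A (set_interval X R B C)"
    using assms by (simp add: set_interval_commute set_interval_subset)
  finally show "set_interval X R (set_interval X R A B) C
    \<subseteq> set_interval X R A (set_interval X R B C)" .
qed (use assms in \<open>rule set_interval_subassoc\<close>)

lemma subassoc_imp_comm_semigroup:
  "interval_subassoc X R \<Longrightarrow> comm_semigroup_on (Pow X) (set_interval X R)"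
  unfolding comm_semigroup_on_def semigroup_on_def
  by (intro conjI ballI set_interval_assoc set_interval_commute)
    (auto simp: mem_set_interval_iff)

lemma semigroup_imp_associative_on_points:
  assumes "semigroup_on (Pow X) (set_interval X R)" "a \<in> X" "b \<in> X" "c \<in> X"
  shows "set_interval X R {a} (interval X R b c) = set_interval X R (interval X R a b) {c}"
proof -
  have "set_interval X R (set_interval X R {a} {b}) {c}
      = set_interval X R {a} (set_interval X R {b} {c})"
    using assms unfolding semigroup_on_def by blast
  then show ?thesis
    by (simp add: set_interval_singletons)
qed

section \<open>Convexity and transitivity from the Peano property\<close>

lemma subassoc_imp_set_interval_convex:
  assumes "interval_subassoc X R" "interval_convex_set X R A" "interval_convex_set X R B"
  shows "interval_convex_set X R (set_interval X R A B)"
proof -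
  let ?S = "set_interval X R"
  have sub: "A \<subseteq> X" "B \<subseteq> X" "?S A A \<subseteq> A" "?S B B \<subseteq> B"
    using assms by (auto simp: interval_convex_set_def)
  note assoc = set_interval_assoc[OF assms(1)]
  \<comment> \<open>Rebracketing brings the two middle factors together, so that they can be swapped
    and equal factors become adjacent.\<close>
  have "?S (?S A B) (?S A B) = ?S A (?S (?S B A) B)"
    using sub by (simp add: assoc set_interval_subset)
  also have "?S B A = ?S A B"
    using sub by (simp add: set_interval_commute)
  also have "?S A (?S (?S A B) B) = ?S (?S A A) (?S B B)"
    using sub by (simp add: assoc set_interval_subset)
  also have "\<dots> \<subseteq> ?S A B"
    using sub by (intro set_interval_mono)
  finally show ?thesis
    by (simp add: interval_convex_set_def set_interval_subset)
qed

text \<open>An interval is the set interval of two singletons, which are convex.\<close>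

lemma subassoc_imp_interval_convex:
  assumes "interval_subassoc X R"
  shows "interval_convex X R"
  unfolding interval_convex_def
  by (simp add: assms subassoc_imp_set_interval_convex interval_convex_set_singleton
      flip: set_interval_singletons)

lemma subassoc_imp_transp_on_convex:
  assumes "interval_subassoc X R" "interval_convex_set X R A"
  shows "transp_on X (set_rel R A)"
proof (rule transp_onI)
  fix x y c
  assume X: "x \<in> X" "y \<in> X" "c \<in> X" and "set_rel R A x y" "set_rel R A y c"
  then obtain u v where uv: "u \<in> A" "v \<in> A" "R u x y" "R v y c"
    by (auto simp: set_rel_def)
  then have "u \<in> X" "v \<in> X"
    using assms(2) by (auto simp: interval_convex_set_def)
  \<comment> \<open>The Peano property merges the two witnesses \<open>u\<close> and
    \<open>v\<close> into one point \<open>z\<close> between them, which convexity keeps in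
    \<open>A\<close>.\<close>
  then obtain z where "z \<in> X" "R u z v" "R z x c"
    using X uv by (auto intro: interval_subassocD[OF assms(1), of u v c x y])
  moreover from this have "z \<in> A"
    using interval_convex_setD[OF assms(2) uv(1,2)] by simp
  ultimately show "set_rel R A x c"
    by (auto simp: set_rel_def)
qed

text \<open>Convexity of intervals allows the second assumption to be used with an interval as
  \<open>A\<close>.\<close>

lemma interval_transitive_if_convex_transitive:
  assumes "interval_convex X R"
    and "\<And>A. interval_convex_set X R A \<Longrightarrow> transp_on X (set_rel R A)"
  shows "interval_transitive X R"
  using assms by (auto simp: interval_transitive_def interval_convex_def)

lemma interval_transitive_iff_subassoc:
  "interval_transitive X R \<longleftrightarrow> interval_subassoc X R"
  using interval_transitive_imp_subassoc interval_transitive_if_convex_transitive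
    subassoc_imp_interval_convex subassoc_imp_transp_on_convex by blast

section \<open>Hulls of three points\<close>

lemma set_interval_subset_co:
  assumes "a \<in> X" "b \<in> X" "c \<in> X"
  shows "set_interval X R {a} (interval X R b c) \<subseteq> co X R {a, b, c}"
    and "set_interval X R (interval X R a b) {c} \<subseteq> co X R {a, b, c}"
proof -
  have conv: "interval_convex_set X R (co X R {a, b, c})"
    using assms by (simp add: interval_convex_set_co)
  let ?C = "co X R {a, b, c}"
  have mem: "a \<in> ?C" "b \<in> ?C" "c \<in> ?C"
    using subset_co[of "{a, b, c}" X R] by auto
  have "interval X R b c \<subseteq> ?C" "interval X R a b \<subseteq> ?C"
    using interval_convex_setD[OF conv mem(2,3)] interval_convex_setD[OF conv mem(1,2)]
    by (auto simp: mem_interval_iff)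
  \<comment> \<open>Both bracketings arise from points of the hull by two interval steps, and the
    hull is closed under each step.\<close>
  then have "set_interval X R {a} (interval X R b c) \<subseteq> set_interval X R ?C ?C"
    "set_interval X R (interval X R a b) {c} \<subseteq> set_interval X R ?C ?C"
    using mem by (simp_all add: set_interval_mono)
  then show "set_interval X R {a} (interval X R b c) \<subseteq> ?C"
    "set_interval X R (interval X R a b) {c} \<subseteq> ?C"
    using conv by (auto simp: interval_convex_set_def)
qed

lemma co_eq_set_interval_if_convex:
  assumes X: "a \<in> X" "b \<in> X" "c \<in> X"
    and conv: "interval_convex_set X R (set_interval X R (interval X R a b) {c})"
  shows "co X R {a, b, c} = set_interval X R (interval X R a b) {c}"
proof
  \<comment> \<open>\<open>a\<close> and \<open>b\<close> lie in their own interval, and every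
    segment ending in \<open>c\<close> contains its two endpoints.\<close>
  have "{a, b, c} \<subseteq> set_interval X R (interval X R a b) {c}"
    using X by (auto simp: mem_interval_iff rel_left rel_right
        intro: set_intervalI[of a] set_intervalI[of b])
  with conv show "co X R {a, b, c} \<subseteq> set_interval X R (interval X R a b) {c}"
    by (rule co_minimal)
qed (use X in \<open>rule set_interval_subset_co\<close>)

end

theorem theorem2p3:
  fixes X :: "'a set" and R :: "'a \<Rightarrow> 'a \<Rightarrow> 'a \<Rightarrow> bool"
  assumes "interval_space X R"
  shows
    "(interval_transitive X R \<longleftrightarrow>
        (\<forall>a\<in>X. \<forall>b\<in>X. \<forall>c\<in>X. set_interval X R {a} (interval X R b c) \<subseteq> set_interval X R (interval X R a b) {c})) \<and>
     (interval_transitive X R \<longleftrightarrow>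
        (\<forall>a\<in>X. \<forall>b\<in>X. \<forall>c\<in>X. set_interval X R {a} (interval X R b c) = set_interval X R (interval X R a b) {c})) \<and>
     (interval_transitive X R \<longleftrightarrow>
        semigroup_on (Pow X) (set_interval X R)) \<and>
     (interval_transitive X R \<longleftrightarrow>
        comm_semigroup_on (Pow X) (set_interval X R)) \<and>
     (interval_transitive X R \<longleftrightarrow>
        (interval_convex X R \<and> (\<forall>A. interval_convex_set X R A \<longrightarrow> transp_on X (set_rel R A)))) \<and>
     (interval_transitive X R \<longleftrightarrow>
        (\<forall>A B. interval_convex_set X R A \<longrightarrow> interval_convex_set X R B \<longrightarrow>
          interval_convex_set X R (set_interval X R A B))) \<and>
     (interval_transitive X R \<longleftrightarrow>
        (\<forall>a\<in>X. \<forall>b\<in>X. \<forall>c\<in>X. interval_convex_set X R (set_interval X R (interval X R a b) {c}))) \<and>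
     (interval_transitive X R \<longleftrightarrow>
        (\<forall>a\<in>X. \<forall>b\<in>X. \<forall>c\<in>X. co X R {a, b, c} = set_interval X R (interval X R a b) {c}))"
proof -
  interpret interval_space X R by fact
  let ?c2 = "interval_subassoc X R"
  let ?c3 = "\<forall>a\<in>X. \<forall>b\<in>X. \<forall>c\<in>X.
    set_interval X R {a} (interval X R b c) = set_interval X R (interval X R a b) {c}"
  let ?c4 = "semigroup_on (Pow X) (set_interval X R)"
  let ?c5 = "comm_semigroup_on (Pow X) (set_interval X R)"
  let ?c6 = "interval_convex X R \<and>
    (\<forall>A. interval_convex_set X R A \<longrightarrow> transp_on X (set_rel R A))"
  let ?c7 = "\<forall>A B. interval_convex_set X R A \<longrightarrow> interval_convex_set X R B \<longrightarrow>
    interval_convex_set X R (set_interval X R A B)"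
  let ?c8 = "\<forall>a\<in>X. \<forall>b\<in>X. \<forall>c\<in>X.
    interval_convex_set X R (set_interval X R (interval X R a b) {c})"
  let ?c9 = "\<forall>a\<in>X. \<forall>b\<in>X. \<forall>c\<in>X.
    co X R {a, b, c} = set_interval X R (interval X R a b) {c}"
  have 12: "interval_transitive X R \<longleftrightarrow> ?c2"
    by (rule interval_transitive_iff_subassoc)
  have 25: "?c2 \<Longrightarrow> ?c5"
    by (rule subassoc_imp_comm_semigroup)
  have 54: "?c5 \<Longrightarrow> ?c4"
    by (simp add: comm_semigroup_on_def)
  have 43: "?c4 \<Longrightarrow> ?c3"
    using semigroup_imp_associative_on_points by blast
  have 32: "?c3 \<Longrightarrow> ?c2"
    by (simp add: interval_subassoc_def)
  have 26: "?c2 \<Longrightarrow> ?c6"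
    using subassoc_imp_interval_convex subassoc_imp_transp_on_convex by blast
  have 61: "?c6 \<Longrightarrow> interval_transitive X R"
    using interval_transitive_if_convex_transitive by blast
  have 27: "?c2 \<Longrightarrow> ?c7"
    using subassoc_imp_set_interval_convex by blast
  \<comment> \<open>\<open>?c7\<close> is applied twice, starting from convex singletons: first to
    the interval, then to its set interval with \<open>{c}\<close>.\<close>
  have 78: "?c7 \<Longrightarrow> ?c8"
    by (simp add: interval_convex_set_singleton flip: set_interval_singletons)
  have 89: "?c8 \<Longrightarrow> ?c9"
    using co_eq_set_interval_if_convex by blast
  \<comment> \<open>The hull always contains \<open>[{a}, [b, c]]\<close>, and \<open>?c9\<close>
    identifies it with the other bracketing.\<close>
  have 92: "?c9 \<Longrightarrow> ?c2"
    unfolding interval_subassoc_def using set_interval_subset_co(1) by blast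
  show ?thesis
    \<comment> \<open>Folding \<open>?c2\<close> in the goal leaves a propositional problem: cycles
      from \<open>?c2\<close> through \<open>?c5\<close>, \<open>?c4\<close>, \<open>?c3\<close>,
      through \<open>?c6\<close> and interval transitivity, and through \<open>?c7\<close>,
      \<open>?c8\<close>, \<open>?c9\<close>.\<close>
    unfolding interval_subassoc_def[symmetric]
    using 12 25 54 43 32 26 61 27 78 89 92 by argo
qed

end
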